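(* Let $\mathcal{M}$ be the class of finite simple maximal planar graphs. The octahedral graph $O=K_{2,2,2}$ satisfies $\operatorname{Cern}_{\mathcal{M}}(O)=2$.
   Context: All graphs are finite and simple. A planar graph is maximal planar if it has at least three vertices and adding any edge between two nonadjacent vertices makes it nonplanar (equivalently, it is a simple triangulation of the sphere). For a graph $G$ and $e\in E(G)$, the graph $G-e$ (edge $e$ deleted, both endpoints retained) is an edge card of $G$. The edge deck $\operatorname{ED}(G)$ is the multiset of isomorphism types of the graphs $G-e$, $e\in E(G)$ (one entry for each edge $e$). For multisets, $S\preccurlyeq T$ means that $S$ is a sub-multiset of $T$ (multiplicities respected). A multiset $S\preccurlyeq\operatorname{ED}(G)$ identifies $G$ within $\mathcal{M}$ if for every $H\in\mathcal{M}$, $S\preccurlyeq\operatorname{ED}(H)$ implies $H\cong G$. The class edge-reconstruction number $\operatorname{Cern}_{\mathcal{M}}(G)$ is the least size, counting multiplicity, of a multiset $S\preccurlyeq\operatorname{ED}(G)$ that identifies $G$ within $\mathcal{M}$; two elements of $S$ may be two copies of the same isomorphism type, up to its multiplicity in $\operatorname{ED}(G)$. *)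

theory Defs
  imports "HOL-Analysis.Analysis" "HOL-Library.Multiset"
begin

text \<open>
  Every finite graph is isomorphic to one whose vertices are natural numbers, so
  quantifying over graphs with vertices in \<^typ>\<open>nat\<close> covers all finite graphs up to
  isomorphism. Edges are two-element sets of vertices.
\<close>

record graph =
  verts :: "nat set"
  edges :: "nat set set"

definition simple_graph :: "graph \<Rightarrow> bool" where
  "simple_graph G \<longleftrightarrow>
     finite (verts G) \<and> (\<forall>e\<in>edges G. e \<subseteq> verts G \<and> card e = 2)"

definition graph_iso :: "graph \<Rightarrow> graph \<Rightarrow> bool" (infix "\<simeq>\<^sub>G" 50) where
  "G \<simeq>\<^sub>G H \<longleftrightarrow>
     (\<exists>f. bij_betw f (verts G) (verts H) \<and>
          (\<forall>u\<in>verts G. \<forall>v\<in>verts G. {u, v} \<in> edges G \<longleftrightarrow> {f u, f v} \<in> edges H))"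

definition iso_type :: "graph \<Rightarrow> graph set" where
  "iso_type G = {H. simple_graph H \<and> G \<simeq>\<^sub>G H}"

definition delete_edge :: "graph \<Rightarrow> nat set \<Rightarrow> graph" where
  "delete_edge G e = \<lparr>verts = verts G, edges = edges G - {e}\<rparr>"

definition add_edge :: "graph \<Rightarrow> nat set \<Rightarrow> graph" where
  "add_edge G e = \<lparr>verts = verts G, edges = insert e (edges G)\<rparr>"

text \<open>
  A drawing without crossings in the plane \<^typ>\<open>complex\<close>: the vertices go to distinct points
  \<open>p v\<close>, and each edge \<open>e\<close> to an arc \<open>\<gamma> e\<close> (an injective path) joining the points of its
  endpoints. An arc contains no other vertex point, and two arcs meet only in the points of
  the endpoints that their edges share.
\<close>

definition plane_drawing :: "graph \<Rightarrow> (nat \<Rightarrow> complex) \<Rightarrow> (nat set \<Rightarrow> real \<Rightarrow> complex) \<Rightarrow> bool"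
  where
  "plane_drawing G p \<gamma> \<longleftrightarrow>
     inj_on p (verts G) \<and>
     (\<forall>e\<in>edges G.
        arc (\<gamma> e) \<and>
        {pathstart (\<gamma> e), pathfinish (\<gamma> e)} = p ` e \<and>
        path_image (\<gamma> e) \<inter> p ` verts G = p ` e) \<and>
     (\<forall>e\<in>edges G. \<forall>e'\<in>edges G. e \<noteq> e' \<longrightarrow>
        path_image (\<gamma> e) \<inter> path_image (\<gamma> e') = p ` (e \<inter> e'))"

definition planar :: "graph \<Rightarrow> bool" where
  "planar G \<longleftrightarrow> (\<exists>p \<gamma>. plane_drawing G p \<gamma>)"

definition maximal_planar :: "graph \<Rightarrow> bool" where
  "maximal_planar G \<longleftrightarrow>
     simple_graph G \<and> planar G \<and> card (verts G) \<ge> 3 \<and>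
     (\<forall>u\<in>verts G. \<forall>v\<in>verts G.
        u \<noteq> v \<and> {u, v} \<notin> edges G \<longrightarrow> \<not> planar (add_edge G {u, v}))"

definition maximal_planar_graphs :: "graph set" where
  "maximal_planar_graphs = {G. maximal_planar G}"

definition edge_deck :: "graph \<Rightarrow> graph set multiset" where
  "edge_deck G = image_mset (\<lambda>e. iso_type (delete_edge G e)) (mset_set (edges G))"

definition identifies_within :: "graph set \<Rightarrow> graph set multiset \<Rightarrow> graph \<Rightarrow> bool" where
  "identifies_within M S G \<longleftrightarrow>
     S \<subseteq># edge_deck G \<and> (\<forall>H\<in>M. S \<subseteq># edge_deck H \<longrightarrow> H \<simeq>\<^sub>G G)"

definition Cern :: "graph set \<Rightarrow> graph \<Rightarrow> nat" where
  "Cern M G = (LEAST k. \<exists>S. identifies_within M S G \<and> size S = k)"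

text \<open>\<open>K\<^sub>2\<^sub>,\<^sub>2\<^sub>,\<^sub>2\<close> with parts \<open>{0, 1}\<close>, \<open>{2, 3}\<close> and \<open>{4, 5}\<close>.\<close>

definition octahedral_graph :: graph where
  "octahedral_graph =
     \<lparr>verts = {..<6}, edges = {{i, j} | i j. i < 6 \<and> j < 6 \<and> i div 2 \<noteq> j div 2}\<rparr>"

end

theory Submission imports Defs begin

text \<open>
  All edge cards of the octahedron are isomorphic to the join of the path 0, 1, 2, 3 with the two
  isolated vertices 4 and 5. A graph with this card arises from it by adding one of the missing
  edges 02, 13, 03, 45. The first two create a \<open>K\<^sub>3\<^sub>,\<^sub>3\<close>, the third gives the octahedron, and the
  fourth gives a maximal planar graph, the twin. The twin has this card, so one card is not
  enough; but it has it only once, since a vertex adjacent to all others survives the removal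
  of any edge other than 45.
\<close>

subsection \<open>Nonplanarity of \<open>K\<^sub>3\<^sub>,\<^sub>3\<close>\<close>

text \<open>Complements explain the list of cases. The complement of the octahedron is the perfect
  matching of antipodal pairs. Deleting an edge links two of these pairs, so the complement of the
  card is the path 2, 0, 3, 1 together with the edge 45. The middle edge 03 is the deleted one, 02
  and 13 are exchanged by reversing the path, and adding 45 leaves only the path missing, which
  makes 4 and 5 universal in the twin. A drawing may use arbitrary arcs, so nonplanarity needs the
  topology of the plane. Every graph to be excluded contains K33 on its own six vertices, without
  subdivisions, so one nonplanarity theorem serves both for the rejected candidates and for the
  maximality of the twin.\<close>

lemma Jordan_curve_separates:
  fixes z :: complex
  assumes "simple_path g" "pathfinish g = pathstart g"
  obtains u where "u \<notin> path_image g" "\<not> connected_component (- path_image g) z u"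
proof -
  define I where "I = inside (path_image g)"
  define E where "E = outside (path_image g)"
  have "I \<noteq> {}" "E \<noteq> {}"
    using Jordan_inside_outside[OF assms] by (auto simp: I_def E_def)
  then obtain x y where xy: "x \<in> I" "y \<in> E"
    by blast
  have "x \<notin> path_image g" "y \<notin> path_image g"
    using xy inside_no_overlap[of "path_image g"] outside_no_overlap[of "path_image g"]
    unfolding I_def E_def by blast+
  moreover have "\<not> connected_component (- path_image g) x y"
    using xy inside_same_component inside_Int_outside unfolding I_def E_def by fastforce
  \<comment> \<open>\<open>z\<close> is connected to at most one of \<open>x\<close> and
    \<open>y\<close>, wherever it lies, so the other one serves as \<open>u\<close>.\<close>
  ultimately show ?thesis
    using that by (meson connected_component_sym connected_component_trans)
qed

text \<open>By this, a component of the complement determines the cycle that bounds it.\<close>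

lemma Jordan_component_frontier:
  fixes u :: complex
  assumes "simple_path g" "pathfinish g = pathstart g" "u \<notin> path_image g"
  shows "frontier (connected_component_set (- path_image g) u) = path_image g"
proof (rule Jordan_Brouwer_frontier)
  show "path_image g homeomorphic sphere (0 :: complex) 1"
    by (rule homeomorphic_simple_path_image_circle) (use assms in auto)
  show "connected_component_set (- path_image g) u \<in> components (- path_image g)"
    using assms(3) by (simp add: componentsI)
qed auto

lemma connected_arc_minus_ends:
  assumes "arc c"
  shows "connected (path_image c - {pathstart c, pathfinish c})"
  using assms by (simp add: arc_imp_simple_path connected_simple_path_endless)

lemma theta_loop:
  assumes "arc c" "arc d" "pathstart c = a" "pathfinish c = b" "pathstart d = a" "pathfinish d = b"
    "path_image c \<inter> path_image d = {a, b}"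
  obtains g where "simple_path g" "pathfinish g = pathstart g"
    "path_image g = path_image c \<union> path_image d"
proof
  show "simple_path (c +++ reversepath d)"
    using assms by (intro simple_path_join_loop) (auto simp: arc_reversepath)
  show "path_image (c +++ reversepath d) = path_image c \<union> path_image d"
    using assms by (simp add: path_image_join)
qed (use assms in auto)

text \<open>No point can reach all three arcs of a theta curve without crossing it. A component of the
  complement of \<open>c 0 \<union> c 1\<close> that misses \<open>z\<close> also misses \<open>c 2\<close>. By Janiszewski's theorem, one of
  the other two cycles must also separate it from \<open>z\<close>; it is then a component of the complement
  of both cycles, which have different frontiers.\<close>

locale theta_star =
  fixes c :: "nat \<Rightarrow> real \<Rightarrow> complex" and a b z :: complex and q :: "nat \<Rightarrow> complex"
    and D :: "nat \<Rightarrow> complex set"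
  assumes arcs: "k < 3 \<Longrightarrow> arc (c k)" "k < 3 \<Longrightarrow> pathstart (c k) = a" "k < 3 \<Longrightarrow> pathfinish (c k) = b"
    and meet: "k < 3 \<Longrightarrow> l < 3 \<Longrightarrow> k \<noteq> l \<Longrightarrow> path_image (c k) \<inter> path_image (c l) = {a, b}"
    and D: "k < 3 \<Longrightarrow> connected (D k)" "k < 3 \<Longrightarrow> z \<in> D k" "k < 3 \<Longrightarrow> q k \<in> D k"
    and q: "k < 3 \<Longrightarrow> q k \<in> path_image (c k) - {a, b}"
    and D_disj: "k < 3 \<Longrightarrow> l < 3 \<Longrightarrow> k \<noteq> l \<Longrightarrow> D k \<inter> path_image (c l) = {}"
begin

definition J :: "nat \<Rightarrow> nat \<Rightarrow> complex set"
  where "J k l = path_image (c k) \<union> path_image (c l)"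

lemma loop:
  assumes "k < 3" "l < 3" "k \<noteq> l"
  obtains g where "simple_path g" "pathfinish g = pathstart g" "path_image g = J k l"
  using theta_loop[of "c k" "c l" a b] assms arcs meet unfolding J_def by metis

text \<open>Go from \<open>z\<close> to \<open>q m\<close> inside \<open>D m\<close>, then along the
  arc \<open>c m\<close> without its ends. Both pieces avoid the cycle formed by the other two
  arcs.\<close>

lemma third_arc_reachable:
  assumes "k < 3" "l < 3" "m < 3" "k \<noteq> l" "k \<noteq> m" "l \<noteq> m" "x \<in> path_image (c m) - {a, b}"
  shows "connected_component (- J k l) z x"
proof -
  have "D m \<subseteq> - J k l"
    using D_disj[of m k] D_disj[of m l] assms by (auto simp: J_def)
  then have "connected_component (- J k l) z (q m)"
    unfolding connected_component_def using D[of m] assms by blast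
  moreover have "connected_component (- J k l) (q m) x"
    unfolding connected_component_def
  proof (intro exI conjI)
    show "connected (path_image (c m) - {a, b})"
      using connected_arc_minus_ends[of "c m"] arcs assms by simp
    show "path_image (c m) - {a, b} \<subseteq> - J k l"
      using meet[of m k] meet[of m l] assms by (auto simp: J_def)
  qed (use assms q in auto)
  ultimately show ?thesis
    by (rule connected_component_trans)
qed

lemma separated_component_avoids:
  assumes "k < 3" "l < 3" "m < 3" "k \<noteq> l" "k \<noteq> m" "l \<noteq> m"
    and sep: "\<not> connected_component (- J k l) z u"
  shows "connected_component_set (- J k l) u \<inter> path_image (c m) = {}"
proof -
  have "x \<notin> path_image (c m)" if "connected_component (- J k l) u x" for x
  proof
    assume "x \<in> path_image (c m)"
    moreover have "x \<notin> J k l"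
      using that connected_component_in by fastforce
    \<comment> \<open>The ends lie on the cycle, so \<open>x\<close> is an interior point of
      \<open>c m\<close> and hence reachable from \<open>z\<close>.\<close>
    moreover have "a \<in> J k l" "b \<in> J k l"
      using arcs[OF assms(1)] by (auto simp: J_def)
    ultimately have "connected_component (- J k l) z x"
      using third_arc_reachable[of k l m x] assms by blast
    then show False
      using sep that by (meson connected_component_sym connected_component_trans)
  qed
  then show ?thesis
    by auto
qed

text \<open>Each of the two components around \<open>u\<close> avoids the third arc, hence the whole
  theta curve, and so lies in the other one. Equal components have equal frontiers, but
  \<open>q l\<close> is on \<open>J k l\<close> and not on \<open>J k m\<close>.\<close>

lemma not_doubly_separated:
  assumes klm: "k < 3" "l < 3" "m < 3" "k \<noteq> l" "k \<noteq> m" "l \<noteq> m"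
    and u: "u \<notin> J k l" "u \<notin> J k m"
    and sep: "\<not> connected_component (- J k l) z u" "\<not> connected_component (- J k m) z u"
  shows False
proof -
  let ?V = "connected_component_set (- J k l) u" and ?W = "connected_component_set (- J k m) u"
  have V: "?V \<inter> path_image (c m) = {}"
    by (rule separated_component_avoids) (use assms in auto)
  have W: "?W \<inter> path_image (c l) = {}"
    by (rule separated_component_avoids) (use assms in auto)
  have V': "?V \<subseteq> - J k l" and W': "?W \<subseteq> - J k m"
    by (simp_all add: connected_component_subset)
  have "?V \<subseteq> ?W"
    by (rule connected_component_maximal) (use V V' u in \<open>auto simp: J_def\<close>)
  moreover have "?W \<subseteq> ?V"
    by (rule connected_component_maximal) (use W W' u in \<open>auto simp: J_def\<close>)
  ultimately have "frontier ?V = frontier ?W"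
    by simp
  moreover have "frontier ?V = J k l"
    using loop[of k l] Jordan_component_frontier u klm by metis
  moreover have "frontier ?W = J k m"
    using loop[of k m] Jordan_component_frontier u klm by metis
  ultimately have "q l \<in> J k m"
    using q klm by (auto simp: J_def)
  then show False
    using q[of l] meet[of l k] meet[of l m] klm by (auto simp: J_def)
qed

lemma contradiction: False
proof -
  obtain u where u: "u \<notin> J 0 1" and sep: "\<not> connected_component (- J 0 1) z u"
    using loop[of 0 1] Jordan_curve_separates[of _ z]
    by (metis one_less_numeral_iff semiring_norm(77) zero_less_numeral zero_neq_one)
  have "connected_component_set (- J 0 1) u \<inter> path_image (c 2) = {}"
    by (rule separated_component_avoids) (use sep in auto)
  moreover have "connected_component (- J 0 1) u u"
    using u by (simp add: connected_component_refl)
  ultimately have "u \<notin> path_image (c 2)"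
    by blast
  then have u': "u \<notin> J 0 2" "u \<notin> J 1 2"
    using u by (auto simp: J_def)
  have J_commute: "J 1 0 = J 0 1"
    by (auto simp: J_def)
  have "connected_component (- J 0 2) z u"
    using not_doubly_separated[of 0 1 2 u] u u' sep by auto
  moreover have "connected_component (- J 1 2) z u"
    using not_doubly_separated[of 1 0 2 u] u u' sep unfolding J_commute by auto
  \<comment> \<open>Janiszewski's theorem asks for a connected intersection of the two closed sets;
    here it is a single arc.\<close>
  moreover have "J 0 2 \<inter> J 1 2 = path_image (c 2)"
  proof -
    have "{a, b} \<subseteq> path_image (c 2)"
      using arcs[of 2] pathstart_in_path_image[of "c 2"] pathfinish_in_path_image[of "c 2"] by simp
    moreover have "path_image (c 0) \<inter> path_image (c 1) = {a, b}"
      by (rule meet) auto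
    ultimately show ?thesis
      unfolding J_def by blast
  qed
  moreover have "compact (J 0 2)" "compact (J 1 2)" "connected (path_image (c 2))"
    using arcs by (auto simp: J_def intro!: compact_Un compact_arc_image connected_arc_image)
  ultimately have "connected_component (- (J 0 2 \<union> J 1 2)) z u"
    using Janiszewski[of "J 0 2" "J 1 2" z u] compact_imp_closed by auto
  then have "connected_component (- J 0 1) z u"
    by (rule connected_component_of_subset) (auto simp: J_def)
  with sep show False ..
qed

end

section \<open>The theta curve inside a drawing of K33\<close>

text \<open>A drawing fixes only the unordered pair of end points of an arc, so the arc may have to
  be reversed before arcs can be joined.\<close>

lemma plane_drawing_arc:
  assumes "plane_drawing G p \<gamma>" "{u, v} \<in> edges G"
  obtains h where "arc h" "pathstart h = p u" "pathfinish h = p v"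
    "path_image h = path_image (\<gamma> {u, v})"
proof -
  have arc: "arc (\<gamma> {u, v})" and ends: "{pathstart (\<gamma> {u, v}), pathfinish (\<gamma> {u, v})} = {p u, p v}"
    using assms unfolding plane_drawing_def by auto
  from ends consider "pathstart (\<gamma> {u, v}) = p u" "pathfinish (\<gamma> {u, v}) = p v"
    | "pathstart (\<gamma> {u, v}) = p v" "pathfinish (\<gamma> {u, v}) = p u"
    by (auto simp: doubleton_eq_iff)
  then show ?thesis
  proof cases
    case 1
    with arc that show ?thesis by blast
  next
    case 2
    with arc show ?thesis
      by (intro that[of "reversepath (\<gamma> {u, v})"]) (auto simp: arc_reversepath)
  qed
qed

text \<open>Two vertices of \<open>A\<close> are the ends of a theta curve with one arc through each
  vertex of \<open>B\<close>. The third vertex of \<open>A\<close> reaches all three arcs along its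
  own edges, which is what \<open>theta_star\<close> refutes.\<close>

lemma K33_not_planar:
  assumes AB: "A \<subseteq> verts G" "B \<subseteq> verts G" "A \<inter> B = {}" "card A = 3" "card B = 3"
    and edge: "\<And>x y. x \<in> A \<Longrightarrow> y \<in> B \<Longrightarrow> {x, y} \<in> edges G"
  shows "\<not> planar G"
proof
  assume "planar G"
  then obtain p \<gamma> where draw: "plane_drawing G p \<gamma>"
    unfolding planar_def by blast
  have inj: "inj_on p (verts G)"
    using draw by (simp add: plane_drawing_def)
  have "finite A" "finite B"
    using AB by (simp_all add: card_ge_0_finite)
  then obtain s t :: "nat \<Rightarrow> nat" where "bij_betw s {0..<3} A" "bij_betw t {0..<3} B"
    using ex_bij_betw_nat_finite AB by metis
  then have bij: "inj_on s {0..<3}" "s ` {0..<3} = A" "inj_on t {0..<3}" "t ` {0..<3} = B"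
    by (simp_all add: bij_betw_def)
  have s: "s i \<in> A" and t: "t i \<in> B" if "i < 3" for i
    using bij that by auto
  have s_neq: "s i \<noteq> s j" and t_neq: "t i \<noteq> t j" if "i < 3" "j < 3" "i \<noteq> j" for i j
    using bij that by (auto dest: inj_onD)
  have st: "s i \<noteq> t j" if "i < 3" "j < 3" for i j
    using s[OF that(1)] t[OF that(2)] AB(3) by auto
  define R where "R i j = path_image (\<gamma> {s i, t j})" for i j
  have R: "R i j \<inter> R i' j' = p ` ({s i, t j} \<inter> {s i', t j'})"
    if "i < 3" "j < 3" "i' < 3" "j' < 3" "i \<noteq> i' \<or> j \<noteq> j'" for i j i' j'
  proof -
    have "{s i, t j} \<noteq> {s i', t j'}"
      using that s_neq[of i i'] t_neq[of j j'] st[of i j'] st[of i' j]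
      by (auto simp: doubleton_eq_iff)
    moreover have "{s i, t j} \<in> edges G" "{s i', t j'} \<in> edges G"
      using edge s t that by auto
    ultimately show ?thesis
      using draw unfolding plane_drawing_def R_def by simp
  qed
  have R_same: "R i j \<inter> R i j' = {p (s i)}" if "i < 3" "j < 3" "j' < 3" "j \<noteq> j'" for i j j'
    using R[of i j i j'] t_neq[of j j'] st that by auto
  have R_same': "R i j \<inter> R i' j = {p (t j)}" if "i < 3" "j < 3" "i' < 3" "i \<noteq> i'" for i j i'
    using R[of i j i' j] s_neq[of i i'] st[of i j] st[of i' j] that by auto
  have R_diff: "R i j \<inter> R i' j' = {}" if "i < 3" "j < 3" "i' < 3" "j' < 3" "i \<noteq> i'" "j \<noteq> j'"
    for i j i' j'
    using R[of i j i' j'] s_neq[of i i'] t_neq[of j j'] st[of i j'] st[of i' j] that by auto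
  have "\<exists>h. arc h \<and> pathstart h = p (s 0) \<and> pathfinish h = p (s 1) \<and> path_image h = R 0 k \<union> R 1 k"
    if k: "k < 3" for k
  proof -
    obtain h1 where h1: "arc h1" "pathstart h1 = p (s 0)" "pathfinish h1 = p (t k)" "path_image h1 = R 0 k"
      unfolding R_def using plane_drawing_arc[OF draw edge[OF s t]] k by (metis zero_less_numeral)
    obtain h2 where h2: "arc h2" "pathstart h2 = p (t k)" "pathfinish h2 = p (s 1)" "path_image h2 = R 1 k"
      unfolding R_def using plane_drawing_arc[of G p \<gamma> "t k" "s 1"] draw edge[of "s 1" "t k"] s t k
      by (metis insert_commute one_less_numeral_iff semiring_norm(77))
    have "arc (h1 +++ h2)"
      using h1 h2 R_same'[of 0 k 1] k by (intro arc_join) auto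
    moreover have "path_image (h1 +++ h2) = R 0 k \<union> R 1 k"
      using h1 h2 by (simp add: path_image_join)
    ultimately show ?thesis
      using h1 h2 by (intro exI[of _ "h1 +++ h2"]) auto
  qed
  then obtain c where c: "\<And>k. k < 3 \<Longrightarrow> arc (c k)" "\<And>k. k < 3 \<Longrightarrow> pathstart (c k) = p (s 0)"
    "\<And>k. k < 3 \<Longrightarrow> pathfinish (c k) = p (s 1)" "\<And>k. k < 3 \<Longrightarrow> path_image (c k) = R 0 k \<union> R 1 k"
    by metis
  have R2: "arc (\<gamma> {s 2, t k})" "p (s 2) \<in> R 2 k" "p (t k) \<in> R 2 k" if k: "k < 3" for k
  proof -
    have "{s 2, t k} \<in> edges G"
      using edge s t k by simp
    then have "arc (\<gamma> {s 2, t k})" "R 2 k \<inter> p ` verts G = p ` {s 2, t k}"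
      using draw unfolding plane_drawing_def R_def by simp_all
    then show "arc (\<gamma> {s 2, t k})"
      by simp
    have "p ` {s 2, t k} \<subseteq> R 2 k"
      using \<open>R 2 k \<inter> p ` verts G = p ` {s 2, t k}\<close> by blast
    then show "p (s 2) \<in> R 2 k" "p (t k) \<in> R 2 k"
      by auto
  qed
  have pt: "p (t k) \<noteq> p (s i)" if "i < 3" "k < 3" for i k
    using inj_onD[OF inj, of "t k" "s i"] s[of i] t[of k] st[of i k] that AB by auto
  have "theta_star c (p (s 0)) (p (s 1)) (p (s 2)) (\<lambda>k. p (t k)) (R 2)"
  proof
    fix k l :: nat assume kl: "k < 3" "l < 3" "k \<noteq> l"
    show "path_image (c k) \<inter> path_image (c l) = {p (s 0), p (s 1)}"
      using c(4) kl R_same[of 0 k l] R_same[of 1 k l] R_diff[of 0 k 1 l] R_diff[of 1 k 0 l]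
      by auto
    show "R 2 k \<inter> path_image (c l) = {}"
      using c(4) kl R_diff[of 2 k 0 l] R_diff[of 2 k 1 l] by auto
  next
    fix k :: nat assume k: "k < 3"
    show "connected (R 2 k)"
      using R2(1)[OF k] by (simp add: R_def connected_arc_image)
    show "p (t k) \<in> path_image (c k) - {p (s 0), p (s 1)}"
      using c(4)[OF k] R_same'[of 0 k 1] pt k by auto
  qed (use c R2 in auto)
  then show False
    by (rule theta_star.contradiction)
qed

subsection \<open>The edge card of the octahedron and its twin\<close>

definition octahedron_card :: graph where
  "octahedron_card = \<lparr>verts = {..<6},
     edges = {{i, j} | i j. i < 6 \<and> j < 6 \<and> i \<noteq> j} - {{0, 2}, {1, 3}, {0, 3}, {4, 5}}\<rparr>"

definition twin :: graph where
  "twin = add_edge octahedron_card {4, 5}"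

lemma verts_octahedron_card [simp]: "verts octahedron_card = {..<6}"
  by (simp add: octahedron_card_def)

lemma octahedron_card_edge_iff:
  "{u, v} \<in> edges octahedron_card \<longleftrightarrow>
     u < 6 \<and> v < 6 \<and> u \<noteq> v \<and> {u, v} \<notin> {{0, 2}, {1, 3}, {0, 3}, {4, 5}}"
proof -
  have "{u, v} \<in> {{i, j} | i j. i < 6 \<and> j < 6 \<and> i \<noteq> j} \<longleftrightarrow> u < (6::nat) \<and> v < 6 \<and> u \<noteq> v"
    by (auto simp: doubleton_eq_iff)
  then show ?thesis
    unfolding octahedron_card_def graph.simps Diff_iff by (simp only: conj_assoc)
qed

lemma simple_octahedron_card: "simple_graph octahedron_card"
proof -
  have "e \<subseteq> {..<6} \<and> card e = 2" if "e \<in> {{i, j} | i j. i < 6 \<and> j < 6 \<and> i \<noteq> j}" for e :: "nat set"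
    using that by auto
  then show ?thesis
    unfolding simple_graph_def octahedron_card_def graph.simps by (meson DiffE finite_lessThan)
qed

lemma verts_twin [simp]: "verts twin = {..<6}"
  by (simp add: twin_def add_edge_def)

lemma twin_edge_iff:
  "{u, v} \<in> edges twin \<longleftrightarrow>
     u < 6 \<and> v < 6 \<and> u \<noteq> v \<and> {u, v} \<notin> {{0, 2}, {1, 3}, {0, 3}}"
proof -
  have "{u, v} \<in> edges twin \<longleftrightarrow> {u, v} = {4, 5} \<or> {u, v} \<in> edges octahedron_card"
    by (simp add: twin_def add_edge_def)
  moreover have "u < 6 \<and> v < 6 \<and> u \<noteq> v \<and> {u, v} \<notin> {{0, 2}, {1, 3}, {0, 3}}" if "{u, v} = {4, 5}"
  proof -
    have "u = 4 \<and> v = 5 \<or> u = 5 \<and> v = 4"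
      using that by (simp add: doubleton_eq_iff)
    then show ?thesis
      by (elim disjE) (simp_all add: doubleton_eq_iff)
  qed
  ultimately show ?thesis
    unfolding octahedron_card_edge_iff by (cases "{u, v} = {4, 5}") simp_all
qed

lemma simple_twin: "simple_graph twin"
  using simple_octahedron_card by (simp add: simple_graph_def twin_def add_edge_def)

lemma less_6_cases: "(n::nat) < 6 \<longleftrightarrow> n = 0 \<or> n = 1 \<or> n = 2 \<or> n = 3 \<or> n = 4 \<or> n = 5"
  by auto

text \<open>The twelve edges by kind, smaller end first: three on the path, four to 4, four to 5,
  and 45. The kinds match the shapes of the segments in the drawing.\<close>

lemma twin_edgeE:
  assumes "e \<in> edges twin"
  obtains u v where "e = {u, v}"
    "v = u + 1 \<and> u < 3 \<or> v = 4 \<and> u < 4 \<or> v = 5 \<and> u < 4 \<or> v = 5 \<and> u = 4"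
proof -
  have "card e = 2"
    using assms simple_twin by (auto simp: simple_graph_def)
  then obtain x y where "e = {x, y}" "x \<noteq> y"
    by (auto simp: card_2_iff)
  then obtain u v where e: "e = {u, v}" and uv: "u < v"
    by (metis insert_commute nat_neq_iff)
  have "v < 6" "{u, v} \<notin> {{0, 2}, {1, 3}, {0, 3}}"
    using assms twin_edge_iff[of u v] by (simp_all add: e)
  then have "v = u + 1 \<and> u < 3 \<or> v = 4 \<and> u < 4 \<or> v = 5 \<and> u < 4 \<or> v = 5 \<and> u = 4"
    using uv unfolding less_6_cases by (elim disjE) (simp_all, (simp_all add: doubleton_eq_iff)?, linarith+)
  with e that show ?thesis
    by blast
qed

text \<open>The path 0, 1, 2, 3 runs up the imaginary axis; 4 and 5 see it from the two sides, and the
  edge between them passes below it.\<close>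

definition twin_point :: "nat \<Rightarrow> complex" where
  "twin_point v = (if v < 4 then Complex 0 (real v + 1) else if v = 4 then -1 else 1)"

text \<open>All edges are straight; \<open>Min\<close> and \<open>Max\<close> orient an edge that is
  given only as a set.\<close>

definition twin_arc :: "nat set \<Rightarrow> real \<Rightarrow> complex" where
  "twin_arc e = linepath (twin_point (Min e)) (twin_point (Max e))"

lemma twin_point_inj: "inj_on twin_point {..<6}"
  by (auto simp: inj_on_def twin_point_def complex_eq_iff split: if_splits)

lemma twin_arc_image:
  assumes "u < v"
  shows "path_image (twin_arc {u, v}) = closed_segment (twin_point u) (twin_point v)"
  using assms by (simp add: twin_arc_def min_def max_def)

text \<open>Coordinate equations of the segments, deliberately relaxed: a slanted edge is prolonged
  to a ray beyond -1 or 1, and the edge 45 to the whole real line. The prolonged sets still meet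
  only at common ends, and the real line misses the path because the path starts at height
  1.\<close>

definition on_twin_arc :: "nat \<Rightarrow> nat \<Rightarrow> complex \<Rightarrow> bool" where
  "on_twin_arc u v z \<longleftrightarrow>
     v = u + 1 \<and> u < 3 \<and> Re z = 0 \<and> real u + 1 \<le> Im z \<and> Im z \<le> real u + 2 \<or>
     v = 4 \<and> u < 4 \<and> Re z \<le> 0 \<and> Im z = (real u + 1) * (1 + Re z) \<or>
     v = 5 \<and> u < 4 \<and> Re z \<ge> 0 \<and> Im z = (real u + 1) * (1 - Re z) \<or>
     v = 5 \<and> u = 4 \<and> Im z = 0"

lemma on_twin_arcI:
  assumes uv: "v = u + 1 \<and> u < 3 \<or> v = 4 \<and> u < 4 \<or> v = 5 \<and> u < 4 \<or> v = 5 \<and> u = 4"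
    and z: "z \<in> closed_segment (twin_point u) (twin_point v)"
  shows "on_twin_arc u v z"
proof -
  obtain t where t: "0 \<le> t" "t \<le> 1" and z_eq: "z = (1 - t) *\<^sub>R twin_point u + t *\<^sub>R twin_point v"
    using z by (auto simp: closed_segment_def)
  from uv consider "v = u + 1" "u < 3" | "v = 4" "u < 4" | "v = 5" "u < 4" | "v = 5" "u = 4"
    by auto
  then show ?thesis
  proof cases
    case 1
    then have "Re z = 0" "Im z = real u + 1 + t"
      by (simp_all add: z_eq twin_point_def algebra_simps)
    with 1 t show ?thesis
      by (simp add: on_twin_arc_def)
  qed (use t in \<open>auto simp: on_twin_arc_def z_eq twin_point_def algebra_simps\<close>)
qed

text \<open>Rays on the same side have different slopes and meet only at their common vertex 4 or 5;
  rays on opposite sides can meet only on the imaginary axis. The order in \<open>less\<close> takes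
  each pair of edges once.\<close>

lemma on_twin_arc_meet:
  assumes z: "on_twin_arc u v z" "on_twin_arc u' v' z" and less: "v < v' \<or> v = v' \<and> u < u'"
  shows "\<exists>x \<in> {u, v} \<inter> {u', v'}. z = twin_point x"
proof -
  from z(1) consider
      (path) "v = u + 1" "u < 3" "Re z = 0" "real u + 1 \<le> Im z" "Im z \<le> real u + 2"
    | (left) "v = 4" "u < 4" "Re z \<le> 0" "Im z = (real u + 1) * (1 + Re z)"
    | (right) "v = 5" "u < 4" "Re z \<ge> 0" "Im z = (real u + 1) * (1 - Re z)"
    | (base) "v = 5" "u = 4" "Im z = 0"
    unfolding on_twin_arc_def by blast
  note c1 = this
  from z(2) consider
      (path') "v' = u' + 1" "u' < 3" "Re z = 0" "real u' + 1 \<le> Im z" "Im z \<le> real u' + 2"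
    | (left') "v' = 4" "u' < 4" "Re z \<le> 0" "Im z = (real u' + 1) * (1 + Re z)"
    | (right') "v' = 5" "u' < 4" "Re z \<ge> 0" "Im z = (real u' + 1) * (1 - Re z)"
    | (base') "v' = 5" "u' = 4" "Im z = 0"
    unfolding on_twin_arc_def by blast
  note c2 = this
  show ?thesis
    using c1
  proof cases
    case path
    show ?thesis
      using c2
    proof cases
      case path'
      with path less have "u' = v" "Im z = real v + 1"
        by auto
      with path show ?thesis
        by (auto simp: twin_point_def complex_eq_iff)
    next
      \<comment> \<open>The ray reaches the imaginary axis at the integer height
        \<open>u' + 1\<close>, which must be an end of the interval from \<open>u + 1\<close> to
        \<open>u + 2\<close>.\<close>
      case left'
      with path have "u' = u \<or> u' = v" "Im z = real u' + 1"
        by auto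
      with left' path show ?thesis
        by (auto simp: twin_point_def complex_eq_iff)
    next
      case right'
      with path have "u' = u \<or> u' = v" "Im z = real u' + 1"
        by auto
      with right' path show ?thesis
        by (auto simp: twin_point_def complex_eq_iff)
    qed (use path in auto)
  next
    case left
    show ?thesis
      using c2
    proof cases
      case left'
      \<comment> \<open>The difference of the two line equations.\<close>
      with left less have "(real u' - real u) * (1 + Re z) = 0" "u < u'"
        by (auto simp: algebra_simps)
      then have "Re z = -1"
        by auto
      with left left' show ?thesis
        by (auto simp: twin_point_def complex_eq_iff)
    next
      case right'
      with left have "Re z = 0"
        by auto
      with left right' show ?thesis
        by (auto simp: twin_point_def complex_eq_iff)
    next
      case base'
      with left have "Re z = -1"
        by auto
      with left base' show ?thesis
        by (auto simp: twin_point_def complex_eq_iff)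
    qed (use left less in auto)
  next
    case right
    show ?thesis
      using c2
    proof cases
      case right'
      with right less have "(real u' - real u) * (1 - Re z) = 0" "u < u'"
        by (auto simp: algebra_simps)
      then have "Re z = 1"
        by auto
      with right right' show ?thesis
        by (intro bexI[of _ 5]) (auto simp: twin_point_def complex_eq_iff)
    next
      case base'
      with right have "Re z = 1"
        by auto
      with right base' show ?thesis
        by (auto simp: twin_point_def complex_eq_iff)
    qed (use right less in auto)
  next
    case base
    with z(2) less show ?thesis
      by (auto simp: on_twin_arc_def)
  qed
qed

lemma on_twin_arc_point:
  assumes "on_twin_arc u v (twin_point x)" "x < 6"
  shows "x \<in> {u, v}"
  using assms by (auto simp: on_twin_arc_def twin_point_def split: if_splits)

lemma planar_twin: "planar twin"
proof -
  have "plane_drawing twin twin_point twin_arc"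
    unfolding plane_drawing_def
  proof (intro conjI ballI impI)
    show "inj_on twin_point (verts twin)"
      using twin_point_inj by simp
  next
    fix e assume e: "e \<in> edges twin"
    obtain u v where uv: "e = {u, v}"
      and kind: "v = u + 1 \<and> u < 3 \<or> v = 4 \<and> u < 4 \<or> v = 5 \<and> u < 4 \<or> v = 5 \<and> u = 4"
      using twin_edgeE[OF e] .
    then have less: "u < v" and less6: "u < 6" "v < 6"
      by auto
    then have "twin_point u \<noteq> twin_point v"
      using inj_on_eq_iff[OF twin_point_inj, of u v] by simp
    then show "arc (twin_arc e)"
      using less uv by (simp add: twin_arc_def min_def max_def)
    show "{pathstart (twin_arc e), pathfinish (twin_arc e)} = twin_point ` e"
      using less uv by (simp add: twin_arc_def min_def max_def)
    have "x \<in> e" if "x < 6" "twin_point x \<in> path_image (twin_arc e)" for x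
      unfolding uv
      by (rule on_twin_arc_point[OF on_twin_arcI[OF kind]])
        (use twin_arc_image[OF less] that in \<open>simp_all only: uv\<close>)
    moreover have "twin_point ` e \<subseteq> path_image (twin_arc e)"
      unfolding uv twin_arc_image[OF less] by simp
    moreover have "e \<subseteq> verts twin"
      using less6 by (simp add: uv)
    ultimately show "path_image (twin_arc e) \<inter> twin_point ` verts twin = twin_point ` e"
      by (intro subset_antisym subsetI) auto
  next
    fix e e' assume e: "e \<in> edges twin" and e': "e' \<in> edges twin" and neq: "e \<noteq> e'"
    obtain u v where uv: "e = {u, v}"
      and kind: "v = u + 1 \<and> u < 3 \<or> v = 4 \<and> u < 4 \<or> v = 5 \<and> u < 4 \<or> v = 5 \<and> u = 4"
      using twin_edgeE[OF e] .
    obtain u' v' where uv': "e' = {u', v'}"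
      and kind': "v' = u' + 1 \<and> u' < 3 \<or> v' = 4 \<and> u' < 4 \<or> v' = 5 \<and> u' < 4 \<or> v' = 5 \<and> u' = 4"
      using twin_edgeE[OF e'] .
    have less: "u < v" "u' < v'"
      using kind kind' by auto
    note im = twin_arc_image[OF less(1)] twin_arc_image[OF less(2)]
    have "\<exists>x \<in> e \<inter> e'. z = twin_point x"
      if "z \<in> path_image (twin_arc e)" "z \<in> path_image (twin_arc e')" for z
    proof -
      have z: "on_twin_arc u v z" "on_twin_arc u' v' z"
        by (rule on_twin_arcI[OF kind], use that im in \<open>simp only: uv uv'\<close>)
          (rule on_twin_arcI[OF kind'], use that im in \<open>simp only: uv uv'\<close>)
      consider "v < v' \<or> v = v' \<and> u < u'" | "v' < v \<or> v' = v \<and> u' < u"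
        using neq uv uv' by fastforce
      then show ?thesis
      proof cases
        case 1
        then show ?thesis
          using on_twin_arc_meet[OF z 1] by (simp only: uv uv')
      next
        case 2
        then show ?thesis
          using on_twin_arc_meet[OF z(2,1) 2] by (simp only: uv uv' Int_commute)
      qed
    qed
    moreover have "twin_point ` e \<subseteq> path_image (twin_arc e)" "twin_point ` e' \<subseteq> path_image (twin_arc e')"
      unfolding uv uv' im by simp_all
    ultimately show "path_image (twin_arc e) \<inter> path_image (twin_arc e') = twin_point ` (e \<inter> e')"
      by (intro subset_antisym subsetI) (auto simp: image_iff)
  qed
  then show ?thesis
    unfolding planar_def by blast
qed

subsection \<open>Isomorphisms and edge decks\<close>

text \<open>\<open>graph_iso\<close> hides its map. The map itself is needed to transport an added
  edge and to speak of the images of 4 and 5.\<close>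

definition iso_map :: "(nat \<Rightarrow> nat) \<Rightarrow> graph \<Rightarrow> graph \<Rightarrow> bool" where
  "iso_map f G H \<longleftrightarrow> bij_betw f (verts G) (verts H) \<and>
     (\<forall>u\<in>verts G. \<forall>v\<in>verts G. {u, v} \<in> edges G \<longleftrightarrow> {f u, f v} \<in> edges H)"

lemma graph_iso_iff: "G \<simeq>\<^sub>G H \<longleftrightarrow> (\<exists>f. iso_map f G H)"
  by (simp add: graph_iso_def iso_map_def)

lemma graph_iso_refl: "G \<simeq>\<^sub>G G"
  unfolding graph_iso_iff iso_map_def by (intro exI[of _ id]) simp

lemma iso_map_comp:
  assumes "iso_map f G H" "iso_map g H K"
  shows "iso_map (g \<circ> f) G K"
  unfolding iso_map_def
proof (intro conjI ballI)
  show "bij_betw (g \<circ> f) (verts G) (verts K)"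
    using assms by (auto simp: iso_map_def intro: bij_betw_trans)
  fix u v assume uv: "u \<in> verts G" "v \<in> verts G"
  then have "f u \<in> verts H" "f v \<in> verts H"
    using assms(1) by (auto simp: iso_map_def dest: bij_betwE)
  with uv show "{u, v} \<in> edges G \<longleftrightarrow> {(g \<circ> f) u, (g \<circ> f) v} \<in> edges K"
    using assms by (simp add: iso_map_def)
qed

lemma iso_map_inv:
  assumes "iso_map f G H"
  shows "iso_map (inv_into (verts G) f) H G"
proof -
  have bij: "bij_betw f (verts G) (verts H)"
    using assms by (simp add: iso_map_def)
  note inv = bij_betw_inv_into[OF bij]
  show ?thesis
    unfolding iso_map_def
  proof (intro conjI ballI)
    show "bij_betw (inv_into (verts G) f) (verts H) (verts G)"
      by (rule inv)
    fix u v assume "u \<in> verts H" "v \<in> verts H"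
    then show "{u, v} \<in> edges H \<longleftrightarrow> {inv_into (verts G) f u, inv_into (verts G) f v} \<in> edges G"
      using assms bij_betwE[OF inv] bij_betw_inv_into_right[OF bij] by (simp add: iso_map_def)
  qed
qed

lemma graph_iso_sym: "G \<simeq>\<^sub>G H \<Longrightarrow> H \<simeq>\<^sub>G G"
  unfolding graph_iso_iff using iso_map_inv by blast

lemma graph_iso_trans: "G \<simeq>\<^sub>G H \<Longrightarrow> H \<simeq>\<^sub>G K \<Longrightarrow> G \<simeq>\<^sub>G K"
  unfolding graph_iso_iff using iso_map_comp by blast

lemma iso_type_eqI: "G \<simeq>\<^sub>G H \<Longrightarrow> iso_type G = iso_type H"
  unfolding iso_type_def using graph_iso_sym graph_iso_trans by blast

text \<open>An isomorphism type collects simple graphs only, so \<open>H\<close> lies in its own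
  type because it is simple.\<close>

lemma iso_type_eqD: "iso_type G = iso_type H \<Longrightarrow> simple_graph H \<Longrightarrow> G \<simeq>\<^sub>G H"
  unfolding iso_type_def using graph_iso_refl by blast

lemma simple_delete_edge: "simple_graph G \<Longrightarrow> simple_graph (delete_edge G e)"
  by (simp add: simple_graph_def delete_edge_def)

lemma finite_edges: "simple_graph G \<Longrightarrow> finite (edges G)"
  unfolding simple_graph_def by (rule finite_subset[of _ "Pow (verts G)"]) auto

lemma iso_map_add_edge:
  assumes f: "iso_map f G H" and ab: "a \<in> verts G" "b \<in> verts G"
  shows "iso_map f (add_edge G {a, b}) (add_edge H {f a, f b})"
proof -
  have inj: "inj_on f (verts G)"
    using f by (simp add: iso_map_def bij_betw_def)
  have "{u, v} = {a, b} \<longleftrightarrow> {f u, f v} = {f a, f b}" if "u \<in> verts G" "v \<in> verts G" for u v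
    using that ab inj_on_eq_iff[OF inj] by (simp add: doubleton_eq_iff)
  then show ?thesis
    using f by (simp add: iso_map_def add_edge_def)
qed

text \<open>Lets a K33 be exhibited on numerals in a concrete graph while the conclusion concerns an
  arbitrary isomorphic copy.\<close>

lemma K33_iso_not_planar:
  assumes f: "iso_map f G H" and AB: "A \<subseteq> verts G" "B \<subseteq> verts G" "A \<inter> B = {}" "card A = 3" "card B = 3"
    and edge: "\<And>x y. x \<in> A \<Longrightarrow> y \<in> B \<Longrightarrow> {x, y} \<in> edges G"
  shows "\<not> planar H"
proof (rule K33_not_planar)
  have bij: "inj_on f (verts G)" "f ` verts G = verts H"
    using f by (simp_all add: iso_map_def bij_betw_def)
  show "f ` A \<subseteq> verts H" "f ` B \<subseteq> verts H"
    using image_mono[OF AB(1), of f] image_mono[OF AB(2), of f] bij(2) by simp_all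
  show "f ` A \<inter> f ` B = {}"
    using inj_on_image_Int[OF bij(1) AB(1,2)] AB(3) by simp
  show "card (f ` A) = 3" "card (f ` B) = 3"
    using AB card_image inj_on_subset[OF bij(1)] by metis+
  show "{x, y} \<in> edges H" if xy: "x \<in> f ` A" "y \<in> f ` B" for x y
  proof -
    obtain u v where uv: "u \<in> A" "v \<in> B" "x = f u" "y = f v"
      using xy by blast
    moreover from uv have "u \<in> verts G" "v \<in> verts G"
      using AB(1,2) by auto
    ultimately show ?thesis
      using edge[of u v] f by (simp add: iso_map_def)
  qed
qed

text \<open>The invariant does two jobs: it tells the twin from the octahedron, and the remaining
  cards of the twin from the octahedron's card.\<close>

definition has_universal :: "graph \<Rightarrow> bool" where
  "has_universal G \<longleftrightarrow> (\<exists>v\<in>verts G. \<forall>w\<in>verts G. w \<noteq> v \<longrightarrow> {v, w} \<in> edges G)"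

lemma has_universal_iso:
  assumes "G \<simeq>\<^sub>G H" "has_universal G"
  shows "has_universal H"
proof -
  obtain f where f: "bij_betw f (verts G) (verts H)"
    "\<forall>u\<in>verts G. \<forall>v\<in>verts G. {u, v} \<in> edges G \<longleftrightarrow> {f u, f v} \<in> edges H"
    using assms(1) by (auto simp: graph_iso_def)
  obtain v where v: "v \<in> verts G" "\<forall>w\<in>verts G. w \<noteq> v \<longrightarrow> {v, w} \<in> edges G"
    using assms(2) by (auto simp: has_universal_def)
  have "{f v, w} \<in> edges H" if w: "w \<in> verts H" "w \<noteq> f v" for w
  proof -
    obtain x where "x \<in> verts G" "w = f x"
      using w(1) bij_betw_imp_surj_on[OF f(1)] by (metis imageE)
    then show ?thesis
      using f(2) v w(2) by metis
  qed
  moreover have "f v \<in> verts H"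
    using f(1) v(1) by (auto dest: bij_betwE)
  ultimately show ?thesis
    unfolding has_universal_def by blast
qed

section \<open>Cards of the octahedron and of the twin\<close>

lemma verts_octahedral [simp]: "verts octahedral_graph = {..<6}"
  by (simp add: octahedral_graph_def)

lemma octahedral_edge_iff:
  "{u, v} \<in> edges octahedral_graph \<longleftrightarrow> u < 6 \<and> v < 6 \<and> u div 2 \<noteq> v div 2"
  by (auto simp: octahedral_graph_def doubleton_eq_iff)

lemma simple_octahedral: "simple_graph octahedral_graph"
  by (auto simp: simple_graph_def octahedral_graph_def)

lemma not_universal_octahedral: "\<not> has_universal octahedral_graph"
proof -
  have "\<exists>w<6. w \<noteq> v \<and> {v, w} \<notin> edges octahedral_graph" if "v < 6" for v
  proof -
    \<comment> \<open>Entry \<open>v\<close> of the list is the antipode of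
      \<open>v\<close>.\<close>
    have "[1, 0, 3, 2, 5, 4] ! v < (6::nat)" "[1, 0, 3, 2, 5, 4] ! v \<noteq> v"
      "v div 2 = [1, 0, 3, 2, 5, 4] ! v div 2"
      using that unfolding less_6_cases by (elim disjE; simp)+
    then show ?thesis
      using octahedral_edge_iff by metis
  qed
  then show ?thesis
    by (auto simp: has_universal_def)
qed

lemma not_universal_octahedron_card: "\<not> has_universal octahedron_card"
proof -
  have "\<exists>w<6. w \<noteq> v \<and> {v, w} \<notin> edges octahedron_card" if "v < 6" for v
  proof -
    \<comment> \<open>The list pairs the vertices along the missing edges 02, 13 and 45.\<close>
    have "{v, [2, 3, 0, 1, 5, 4] ! v} \<in> {{0, 2}, {1, 3}, {0, 3}, {4, 5}}" "[2, 3, 0, 1, 5, 4] ! v < (6::nat)"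
      "[2, 3, 0, 1, 5, 4] ! v \<noteq> v"
      using that unfolding less_6_cases by (elim disjE; simp add: insert_commute)+
    then show ?thesis
      using octahedron_card_edge_iff by blast
  qed
  then show ?thesis
    by (auto simp: has_universal_def)
qed

lemma twin_universal:
  assumes "v = 4 \<or> v = 5" "w < 6" "w \<noteq> v"
  shows "{v, w} \<in> edges twin"
  using assms unfolding twin_edge_iff by (auto simp: doubleton_eq_iff)

lemma delete_twin: "delete_edge twin {4, 5} = octahedron_card"
proof -
  have "{4, 5} \<notin> edges octahedron_card"
    unfolding octahedron_card_edge_iff by simp
  then show ?thesis
    by (simp add: twin_def add_edge_def delete_edge_def)
qed

text \<open>The path 0, 1, 2, 3 of the card runs from \<open>i\<close> to \<open>j\<close> through the antipode of \<open>j\<close> and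
  that of \<open>i\<close>.\<close>

definition card_map :: "nat \<Rightarrow> nat \<Rightarrow> nat \<Rightarrow> nat" where
  "card_map i j x = (let anti = (\<lambda>k. if even k then k + 1 else k - 1);
     m = 2 * (3 - i div 2 - j div 2) in [i, anti j, anti i, j, m, m + 1] ! x)"

text \<open>The missing edges 02, 13 and 45 of the card go to the antipodal pairs and 03 goes to the
  deleted edge. The part numbers 0, 1, 2 add up to 3, so \<open>m\<close> in \<open>card_map\<close>
  is the first vertex of the part that contains neither \<open>i\<close> nor
  \<open>j\<close>.\<close>

lemma card_map_iso:
  assumes "i < 6" "j < 6" "i div 2 \<noteq> j div 2"
  shows "iso_map (card_map i j) octahedron_card (delete_edge octahedral_graph {i, j})"
proof -
  \<comment> \<open>A finite evaluation over the 24 ordered pairs of adjacent vertices;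
    \<open>distinct\<close> is the executable form of injectivity.\<close>
  have *: "\<forall>i\<in>set [0..<6]. \<forall>j\<in>set [0..<6]. i div 2 \<noteq> j div 2 \<longrightarrow>
     distinct (map (card_map i j) [0..<6]) \<and>
     (\<forall>u\<in>set [0..<6]. \<forall>v\<in>set [0..<6]. card_map i j u < 6 \<and>
       ((u \<noteq> v \<and> {u, v} \<notin> {{0, 2}, {1, 3}, {0, 3}, {4, 5}}) \<longleftrightarrow>
        (card_map i j u div 2 \<noteq> card_map i j v div 2 \<and> {card_map i j u, card_map i j v} \<noteq> {i, j})))"
    by code_simp
  have bij: "bij_betw (card_map i j) {..<6} {..<6}"
  proof -
    have inj: "inj_on (card_map i j) {..<6}"
      using * assms by (simp add: distinct_map atLeast0LessThan)
    moreover have "card_map i j ` {..<6} \<subseteq> {..<6}"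
      using * assms by auto
    ultimately show ?thesis
      by (simp add: bij_betw_def endo_inj_surj)
  qed
  have "{u, v} \<in> edges octahedron_card \<longleftrightarrow>
      {card_map i j u, card_map i j v} \<in> edges (delete_edge octahedral_graph {i, j})"
    if "u < 6" "v < 6" for u v
  proof -
    have "card_map i j u < 6" "card_map i j v < 6"
      using bij that by (auto dest: bij_betwE)
    then have "{card_map i j u, card_map i j v} \<in> edges (delete_edge octahedral_graph {i, j}) \<longleftrightarrow>
      card_map i j u div 2 \<noteq> card_map i j v div 2 \<and> {card_map i j u, card_map i j v} \<noteq> {i, j}"
      by (simp add: delete_edge_def octahedral_edge_iff)
    also have "\<dots> \<longleftrightarrow> u \<noteq> v \<and> {u, v} \<notin> {{0, 2}, {1, 3}, {0, 3}, {4, 5}}"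
      using * assms that by simp
    finally show ?thesis
      using that by (simp only: octahedron_card_edge_iff simp_thms)
  qed
  with bij show ?thesis
    by (simp add: iso_map_def delete_edge_def)
qed

text \<open>This is the edge-transitivity of the octahedron, obtained from maps out of one fixed
  card instead of automorphisms.\<close>

lemma delete_octahedral_iso_type:
  assumes "e \<in> edges octahedral_graph"
  shows "iso_type (delete_edge octahedral_graph e) = iso_type octahedron_card"
proof -
  obtain i j where "e = {i, j}" "i < 6" "j < 6" "i div 2 \<noteq> j div 2"
    using assms by (auto simp: octahedral_graph_def)
  then have "octahedron_card \<simeq>\<^sub>G delete_edge octahedral_graph e"
    using card_map_iso graph_iso_iff by blast
  then show ?thesis
    by (simp add: iso_type_eqI)
qed

text \<open>\<open>card_map 0 2\<close> sends 0 and 3 to the ends of the deleted edge, so adding 03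
  restores it. In the labelling of \<open>octahedral_graph\<close>, 02 is an edge.\<close>

lemma add_long_diagonal_iso: "add_edge octahedron_card {0, 3} \<simeq>\<^sub>G octahedral_graph"
proof -
  have "iso_map (card_map 0 2) (add_edge octahedron_card {0, 3})
      (add_edge (delete_edge octahedral_graph {0, 2}) {card_map 0 2 0, card_map 0 2 3})"
    by (intro iso_map_add_edge card_map_iso) auto
  moreover have "card_map 0 2 0 = 0" "card_map 0 2 3 = 2"
    by code_simp+
  moreover have "add_edge (delete_edge octahedral_graph {0, 2}) {0, 2} = octahedral_graph"
    using octahedral_edge_iff[of 0 2] by (simp add: add_edge_def delete_edge_def insert_absorb)
  ultimately show ?thesis
    unfolding graph_iso_iff by auto
qed

section \<open>Nonplanar extensions and maximality of the twin\<close>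

text \<open>The vertices 4 and 5 see the whole path. With 02, vertex 2 also sees all of 0, 1, 3,
  which gives K33; 13 is the mirror image. Allowing any supergraph \<open>G\<close> of the card
  covers extensions of the card and of the twin alike.\<close>

lemma add_edge_card_not_planar:
  assumes f: "iso_map f G H" and G: "verts G = {..<6}" "edges octahedron_card \<subseteq> edges G"
    and diag: "{0, 2} \<in> edges G \<or> {1, 3} \<in> edges G"
  shows "\<not> planar H"
proof -
  have base: "{u, v} \<in> edges G" if "u < 6" "v < 6" "u \<noteq> v" "{u, v} \<notin> {{0, 2}, {1, 3}, {0, 3}, {4, 5}}"
    for u v
    using that by (intro subsetD[OF G(2)]) (simp only: octahedron_card_edge_iff simp_thms)
  from diag show ?thesis
  proof
    assume diag: "{0, 2} \<in> edges G"
    have cover: "{x, y} = {0, 2} \<or> x < 6 \<and> y < 6 \<and> x \<noteq> y \<and> {x, y} \<notin> {{0, 2}, {1, 3}, {0, 3}, {4, 5}}"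
      if "x \<in> {0, 1, 3}" "y \<in> {2, 4, 5}" for x y :: nat
      using that by (elim insertE emptyE; simp add: doubleton_eq_iff)
    have E: "{x, y} \<in> edges G" if "x \<in> {0, 1, 3}" "y \<in> {2, 4, 5}" for x y
      using cover[OF that] by (elim disjE conjE) (simp only: diag, rule base)
    show ?thesis
      by (rule K33_iso_not_planar[OF f, of "{0, 1, 3}" "{2, 4, 5}"]) (assumption | rule E | simp add: G(1))+
  next
    assume diag: "{1, 3} \<in> edges G"
    have cover: "{x, y} = {1, 3} \<or> x < 6 \<and> y < 6 \<and> x \<noteq> y \<and> {x, y} \<notin> {{0, 2}, {1, 3}, {0, 3}, {4, 5}}"
      if "x \<in> {0, 2, 3}" "y \<in> {1, 4, 5}" for x y :: nat
      using that by (elim insertE emptyE; simp add: doubleton_eq_iff)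
    have E: "{x, y} \<in> edges G" if "x \<in> {0, 2, 3}" "y \<in> {1, 4, 5}" for x y
      using cover[OF that] by (elim disjE conjE) (simp only: diag, rule base)
    show ?thesis
      by (rule K33_iso_not_planar[OF f, of "{0, 2, 3}" "{1, 4, 5}"]) (assumption | rule E | simp add: G(1))+
  qed
qed

lemma maximal_planar_twin: "maximal_planar twin"
  unfolding maximal_planar_def
proof (intro conjI ballI impI)
  fix u v assume uv: "u \<in> verts twin" "v \<in> verts twin" "u \<noteq> v \<and> {u, v} \<notin> edges twin"
  then have "u < 6" "v < 6" "u \<noteq> v" "{u, v} \<notin> edges twin"
    by simp_all
  then have N: "{u, v} \<in> {{0, 2}, {1, 3}, {0, 3}}"
    using twin_edge_iff[of u v] by satx
  let ?G = "add_edge twin {u, v}"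
  have id: "iso_map id ?G ?G"
    by (simp add: iso_map_def)
  have sub: "edges octahedron_card \<subseteq> edges ?G"
    by (auto simp: twin_def add_edge_def)
  have verts: "verts ?G = {..<6}"
    by (simp add: add_edge_def)
  show "\<not> planar ?G"
  \<comment> \<open>The edge 03 closes the path to a 4-cycle, and 45 supplies the ninth edge of a
    K33 with parts 0, 2, 4 and 1, 3, 5. Without 45 the same addition gives the octahedron, so this
    case is particular to the twin.\<close>
  proof (cases "{u, v} = {0, 3}")
    case True
    have "{x, y} = {0, 3} \<or> {x, y} \<in> edges twin" if "x \<in> {0, 2, 4}" "y \<in> {1, 3, 5}" for x y
      using that unfolding twin_edge_iff by (elim insertE emptyE; simp add: doubleton_eq_iff)
    then have E: "{x, y} \<in> edges ?G" if "x \<in> {0, 2, 4}" "y \<in> {1, 3, 5}" for x y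
      using True that by (simp add: add_edge_def)
    show ?thesis
      by (rule K33_iso_not_planar[OF id, of "{0, 2, 4}" "{1, 3, 5}"]) (assumption | rule E | simp add: verts)+
  next
    case False
    with N have "{u, v} = {0, 2} \<or> {u, v} = {1, 3}"
      by simp
    then have "{0, 2} \<in> edges ?G \<or> {1, 3} \<in> edges ?G"
      by (elim disjE) (simp_all add: add_edge_def)
    then show ?thesis
      by (rule add_edge_card_not_planar[OF id verts sub])
  qed
qed (auto simp: simple_twin planar_twin)

section \<open>Identification by two cards\<close>

lemma edge_deck_two:
  assumes S: "{#t, t#} \<subseteq># edge_deck H"
  obtains e e' where "e \<in> edges H" "e' \<in> edges H" "e \<noteq> e'"
    "iso_type (delete_edge H e) = t" "iso_type (delete_edge H e') = t"
proof -
  let ?T = "{e \<in> edges H. iso_type (delete_edge H e) = t}"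
  have "2 \<le> count (edge_deck H) t"
    using mset_subset_eq_count[OF S, of t] by simp
  \<comment> \<open>\<open>mset_set\<close> of an infinite set is empty, so a positive count forces
    finitely many edges.\<close>
  then have fin: "finite (edges H)"
    unfolding edge_deck_def by (cases "finite (edges H)") auto
  then have "count (edge_deck H) t = (\<Sum>x\<in>?T. 1)"
    unfolding edge_deck_def count_image_mset' by (intro sum.cong) auto
  with \<open>2 \<le> count (edge_deck H) t\<close> have "\<not> card ?T \<le> Suc 0"
    by simp
  then have "\<exists>e\<in>?T. \<exists>e'\<in>?T. e \<noteq> e'"
    using card_le_Suc0_iff_eq[of ?T] fin by auto
  with that show ?thesis
    by blast
qed

text \<open>Pulling the deleted edge back along \<open>f\<close> turns reconstruction from a card
  into a choice among the missing edges of that card.\<close>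

lemma iso_map_add_deleted:
  assumes f: "iso_map f G (delete_edge H e)" and H: "simple_graph H" "e \<in> edges H"
  obtains a b where "a \<in> verts G" "b \<in> verts G" "a \<noteq> b" "{a, b} \<notin> edges G" "e = {f a, f b}"
    "iso_map f (add_edge G {a, b}) H"
proof -
  have bij: "bij_betw f (verts G) (verts H)"
    using f by (simp add: iso_map_def delete_edge_def)
  have "e \<subseteq> verts H" "card e = 2"
    using H by (auto simp: simple_graph_def)
  then obtain x y where xy: "e = {x, y}" "x \<noteq> y" "x \<in> verts H" "y \<in> verts H"
    by (auto simp: card_2_iff)
  then obtain a b where ab: "a \<in> verts G" "b \<in> verts G" "x = f a" "y = f b"
    using bij_betw_imp_surj_on[OF bij] by (metis imageE)
  have "{a, b} \<notin> edges G"
    using f ab xy by (simp add: iso_map_def delete_edge_def)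
  moreover have "add_edge (delete_edge H e) e = H"
    using H(2) by (simp add: add_edge_def delete_edge_def insert_absorb)
  then have "iso_map f (add_edge G {a, b}) H"
    using iso_map_add_edge[OF f ab(1,2)] ab xy by simp
  ultimately show ?thesis
    using that ab xy by auto
qed

lemma twin_unique_card:
  assumes f: "iso_map f twin H" and e: "card e = 2" "e \<noteq> {f 4, f 5}"
  shows "\<not> octahedron_card \<simeq>\<^sub>G delete_edge H e"
proof -
  have inj: "inj_on f {..<6}" and img: "f ` {..<6} = verts H"
    using f by (simp_all add: iso_map_def bij_betw_def)
  have "f 4 \<noteq> f 5"
    using inj_on_eq_iff[OF inj, of 4 5] by simp
  \<comment> \<open>Two-element sets that differ cannot contain one another, so one of the universal
    vertices \<open>f 4\<close> and \<open>f 5\<close> keeps all its edges.\<close>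
  then have "\<not> {f 4, f 5} \<subseteq> e"
    using e card_subset_eq[of e "{f 4, f 5}"] card_ge_0_finite[of e] by auto
  then obtain v where v: "v = 4 \<or> v = 5" "f v \<notin> e"
    by auto
  have "{f v, w} \<in> edges (delete_edge H e)" if "w \<in> verts H" "w \<noteq> f v" for w
  proof -
    obtain x where x: "x < 6" "w = f x"
      using \<open>w \<in> verts H\<close> img by auto
    then have "{v, x} \<in> edges twin"
      using twin_universal v that by blast
    then have "{f v, w} \<in> edges H"
      using f x v by (auto simp: iso_map_def)
    then show ?thesis
      using v by (auto simp: delete_edge_def)
  qed
  moreover have "f v \<in> verts H"
    using img v by auto
  ultimately have "has_universal (delete_edge H e)"
    unfolding has_universal_def by (intro bexI[of _ "f v"]) (auto simp: delete_edge_def)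
  then show ?thesis
    using has_universal_iso graph_iso_sym not_universal_octahedron_card by blast
qed

text \<open>The first card and planarity leave only the octahedron and the twin; the second card
  excludes the twin.\<close>

lemma two_cards_identify:
  assumes H: "simple_graph H" "planar H"
    and S: "{#iso_type octahedron_card, iso_type octahedron_card#} \<subseteq># edge_deck H"
  shows "H \<simeq>\<^sub>G octahedral_graph"
proof -
  obtain e e' where e: "e \<in> edges H" "e' \<in> edges H" "e \<noteq> e'"
    and types: "iso_type (delete_edge H e) = iso_type octahedron_card"
      "iso_type (delete_edge H e') = iso_type octahedron_card"
    using edge_deck_two[OF S] .
  have iso: "octahedron_card \<simeq>\<^sub>G delete_edge H e" "octahedron_card \<simeq>\<^sub>G delete_edge H e'"
    using types iso_type_eqD simple_delete_edge H(1) by metis+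
  obtain f where f: "iso_map f octahedron_card (delete_edge H e)"
    using iso(1) graph_iso_iff by blast
  obtain a b where ab: "a \<in> verts octahedron_card" "b \<in> verts octahedron_card" "a \<noteq> b"
      "{a, b} \<notin> edges octahedron_card" "e = {f a, f b}"
    and g: "iso_map f (add_edge octahedron_card {a, b}) H"
    using iso_map_add_deleted[OF f H(1) e(1)] .
  have "a < 6" "b < 6"
    using ab(1,2) by simp_all
  then have "{a, b} \<in> {{0, 2}, {1, 3}, {0, 3}, {4, 5}}"
    using ab(3,4) octahedron_card_edge_iff[of a b] by satx
  then consider "{a, b} = {0, 2} \<or> {a, b} = {1, 3}" | "{a, b} = {0, 3}" | "{a, b} = {4, 5}"
    by (elim insertE emptyE) simp_all
  then show ?thesis
  proof cases
    case 1
    have "{0, 2} \<in> edges (add_edge octahedron_card {a, b}) \<or>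
        {1, 3} \<in> edges (add_edge octahedron_card {a, b})"
      using 1 by (elim disjE) (simp_all add: add_edge_def)
    then have "\<not> planar H"
      by (intro add_edge_card_not_planar[OF g]) (simp_all add: add_edge_def subset_insertI)
    with H(2) show ?thesis
      by simp
  next
    case 2
    then have "H \<simeq>\<^sub>G add_edge octahedron_card {0, 3}"
      using g graph_iso_iff graph_iso_sym by metis
    with add_long_diagonal_iso show ?thesis
      by (rule graph_iso_trans[rotated])
  next
    \<comment> \<open>Here \<open>e\<close> is the image of 45, so the other edge \<open>e'\<close>
      would have to yield a second copy of the card from the twin.\<close>
    case 3
    then have "iso_map f twin H"
      using g by (simp add: twin_def)
    moreover have "e = {f 4, f 5}"
      using 3 ab(5) by (metis image_empty image_insert)
    moreover have "card e' = 2"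
      using H(1) e(2) by (simp add: simple_graph_def)
    ultimately show ?thesis
      using twin_unique_card iso(2) e(3) by blast
  qed
qed

lemma edge_deck_octahedral:
  "edge_deck octahedral_graph = image_mset (\<lambda>_. iso_type octahedron_card) (mset_set (edges octahedral_graph))"
  unfolding edge_deck_def using finite_edges[OF simple_octahedral]
  by (intro image_mset_cong) (simp add: delete_octahedral_iso_type)

lemma two_cards_subset:
  "{#iso_type octahedron_card, iso_type octahedron_card#} \<subseteq># edge_deck octahedral_graph"
proof -
  let ?E = "edges octahedral_graph"
  have "{{0, 2}, {0, 4}} \<subseteq> ?E"
    using octahedral_edge_iff[of 0 2] octahedral_edge_iff[of 0 4] by simp
  then have "mset_set {{0, 2}, {0, 4}} \<subseteq># mset_set ?E"
    using finite_edges[OF simple_octahedral] by (simp add: subset_imp_msubset_mset_set)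
  from image_mset_subseteq_mono[OF this, of "\<lambda>_. iso_type octahedron_card"] show ?thesis
    by (simp add: edge_deck_octahedral doubleton_eq_iff)
qed

lemma card_in_twin_deck: "iso_type octahedron_card \<in># edge_deck twin"
proof -
  have "{4, 5} \<in> edges twin"
    by (simp add: twin_def add_edge_def)
  moreover have "iso_type octahedron_card = iso_type (delete_edge twin {4, 5})"
    by (simp add: delete_twin)
  ultimately show ?thesis
    unfolding edge_deck_def using finite_edges[OF simple_twin] by auto
qed

lemma one_card_not_identify:
  assumes "size S < 2"
  shows "\<not> identifies_within maximal_planar_graphs S octahedral_graph"
proof
  assume S: "identifies_within maximal_planar_graphs S octahedral_graph"
  then have sub: "S \<subseteq># edge_deck octahedral_graph"
    by (simp add: identifies_within_def)
  \<comment> \<open>All cards of the octahedron have one type, so this bound covers both the empty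
    multiset and every single card.\<close>
  have "S \<subseteq># {#iso_type octahedron_card#}"
  proof (cases "size S = 0")
    case False
    with assms have "size S = 1"
      by linarith
    then obtain x where x: "S = {#x#}"
      by (metis size_1_singleton_mset)
    then have "x \<in># edge_deck octahedral_graph"
      using sub by simp
    then have "x = iso_type octahedron_card"
      by (auto simp: edge_deck_octahedral)
    with x show ?thesis
      by simp
  qed simp
  also have "\<dots> \<subseteq># edge_deck twin"
    using card_in_twin_deck by simp
  finally have "twin \<simeq>\<^sub>G octahedral_graph"
    using S maximal_planar_twin by (simp add: identifies_within_def maximal_planar_graphs_def)
  moreover have "has_universal twin"
    unfolding has_universal_def using twin_universal[of 4] by (intro bexI[of _ 4]) auto
  ultimately show False
    using has_universal_iso not_universal_octahedral by blast
qed

theorem proposition5p3: "Cern maximal_planar_graphs octahedral_graph = 2"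
  unfolding Cern_def
proof (rule Least_equality)
  have "identifies_within maximal_planar_graphs
      {#iso_type octahedron_card, iso_type octahedron_card#} octahedral_graph"
    using two_cards_subset two_cards_identify
    by (simp add: identifies_within_def maximal_planar_graphs_def maximal_planar_def)
  then show "\<exists>S. identifies_within maximal_planar_graphs S octahedral_graph \<and> size S = 2"
    by (intro exI[of _ "{#iso_type octahedron_card, iso_type octahedron_card#}"]) simp
next
  fix k assume "\<exists>S. identifies_within maximal_planar_graphs S octahedral_graph \<and> size S = k"
  then show "2 \<le> k"
    using one_card_not_identify not_le by blast
qed

end
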